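(* A word identity $\mathbf{u}\approx\mathbf{v}$ holds in $(\mathsf{baxt}_4,{}^{\sharp})$ if and only if $\mathbf{u}\approx\mathbf{v}$ is balanced and $\overrightarrow{\mathsf{occ}}_x(y,\mathbf{u})=\overrightarrow{\mathsf{occ}}_x(y,\mathbf{v})$ and $\overleftarrow{\mathsf{occ}}_x(y,\mathbf{u})=\overleftarrow{\mathsf{occ}}_x(y,\mathbf{v})$ for any $x,y\in\mathsf{con}(\mathbf{u})$.
   Context: Baxter monoid: for $n\ge 1$ let $\mathcal{A}_n=\{1<2<\cdots<n\}$ and let $\mathcal{A}_n^{\star}$ be the free monoid on $\mathcal{A}_n$. Then $\mathsf{baxt}_n=\mathcal{A}_n^{\star}/\!\equiv$, where $\equiv$ is the congruence generated by all pairs $(c\mathbf{u}ad\mathbf{v}b,\ c\mathbf{u}da\mathbf{v}b)$ with $a\le b<c\le d$ and $(b\mathbf{u}da\mathbf{v}c,\ b\mathbf{u}ad\mathbf{v}c)$ with $a<b\le c<d$, where $a,b,c,d\in\mathcal{A}_n$, $\mathbf{u},\mathbf{v}\in\mathcal{A}_n^{\star}$. Schützenberger's involution $^{\sharp}$ on $\mathsf{baxt}_n$ is induced by $i^{\sharp}=n+1-i$ and $(w_1\cdots w_k)^{\sharp}=w_k^{\sharp}\cdots w_1^{\sharp}$. Words: $\mathcal{X}$ is a countably infinite alphabet, $\mathcal{X}^*=\{x^*:x\in\mathcal{X}\}$ a disjoint copy; elements of $\mathcal{X}\cup\mathcal{X}^*$ are variables. $\mathsf{con}(\mathbf{u})\subseteq\mathcal{X}\cup\mathcal{X}^*$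 is the set of variables occurring in $\mathbf{u}$; $\mathsf{occ}(x,\mathbf{u})$ is the number of occurrences of the variable $x$ in $\mathbf{u}$ ($x$ and $x^*$ counted separately); $\overleftarrow{\mathsf{occ}}_y(x,\mathbf{u})$ (resp. $\overrightarrow{\mathsf{occ}}_y(x,\mathbf{u})$) is the number of occurrences of $x$ before the first (resp. after the last) occurrence of $y$ in $\mathbf{u}$. A word identity is an expression $\mathbf{u}\approx\mathbf{v}$ with $\mathbf{u},\mathbf{v}\in(\mathcal{X}\cup\mathcal{X}^* )^+$; it holds in an involution monoid $(M,{}^* )$ if for every map $\varphi:\mathcal{X}\to M$, extended by $\varphi(x^* )=\varphi(x)^*$ and multiplicatively to words, $\varphi(\mathbf{u})=\varphi(\mathbf{v})$. It is balanced if $\mathsf{occ}(x,\mathbf{u})=\mathsf{occ}(x,\mathbf{v})$ for all $x\in\mathsf{con}(\mathbf{u}\mathbf{v})$. *)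

theory Defs
  imports "HOL-Algebra.Group"
begin

section \<open>The Baxter monoid of rank \<open>n\<close>\<close>

inductive baxt_rule :: "nat \<Rightarrow> nat list \<Rightarrow> nat list \<Rightarrow> bool" for n :: nat where
  "\<lbrakk>{a, b, c, d} \<subseteq> {1..n}; u \<in> lists {1..n}; v \<in> lists {1..n}; a \<le> b; b < c; c \<le> d\<rbrakk>
    \<Longrightarrow> baxt_rule n ([c] @ u @ [a, d] @ v @ [b]) ([c] @ u @ [d, a] @ v @ [b])"
| "\<lbrakk>{a, b, c, d} \<subseteq> {1..n}; u \<in> lists {1..n}; v \<in> lists {1..n}; a < b; b \<le> c; c < d\<rbrakk>
    \<Longrightarrow> baxt_rule n ([b] @ u @ [d, a] @ v @ [c]) ([b] @ u @ [a, d] @ v @ [c])"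

inductive_set baxt_cong :: "nat \<Rightarrow> (nat list \<times> nat list) set" for n :: nat where
  rule: "baxt_rule n w w' \<Longrightarrow> (w, w') \<in> baxt_cong n"
| refl: "w \<in> lists {1..n} \<Longrightarrow> (w, w) \<in> baxt_cong n"
| sym: "(w, w') \<in> baxt_cong n \<Longrightarrow> (w', w) \<in> baxt_cong n"
| trans: "(w, w') \<in> baxt_cong n \<Longrightarrow> (w', w'') \<in> baxt_cong n \<Longrightarrow> (w, w'') \<in> baxt_cong n"
| append: "(w, w') \<in> baxt_cong n \<Longrightarrow> (z, z') \<in> baxt_cong n \<Longrightarrow> (w @ z, w' @ z') \<in> baxt_cong n"

definition baxt :: "nat \<Rightarrow> nat list set monoid" where
  "baxt n =
    \<lparr>carrier = lists {1..n} // baxt_cong n,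
     mult = (\<lambda>A B. \<Union>w\<in>A. \<Union>z\<in>B. baxt_cong n `` {w @ z}),
     one = baxt_cong n `` {[]}\<rparr>"

definition sharp_word :: "nat \<Rightarrow> nat list \<Rightarrow> nat list" where
  "sharp_word n w = rev (map (\<lambda>i. n + 1 - i) w)"

definition sharp :: "nat \<Rightarrow> nat list set \<Rightarrow> nat list set" where
  "sharp n A = (\<Union>w\<in>A. baxt_cong n `` {sharp_word n w})"

text \<open>The operations on congruence classes do not depend on the choice of representatives.\<close>

lemma baxt_rule_lists:
  "baxt_rule n w w' \<Longrightarrow> w \<in> lists {1..n} \<and> w' \<in> lists {1..n}"
  by (induction rule: baxt_rule.induct) auto

lemma baxt_cong_lists:
  "(w, w') \<in> baxt_cong n \<Longrightarrow> w \<in> lists {1..n} \<and> w' \<in> lists {1..n}"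
  by (induction rule: baxt_cong.induct) (auto dest: baxt_rule_lists)

lemma equiv_baxt_cong: "equiv (lists {1..n}) (baxt_cong n)"
proof (rule equivI)
  show "baxt_cong n \<subseteq> lists {1..n} \<times> lists {1..n}"
  proof (rule subrelI)
    fix w z assume "(w, z) \<in> baxt_cong n"
    then show "(w, z) \<in> lists {1..n} \<times> lists {1..n}"
      unfolding mem_Times_iff fst_conv snd_conv by (rule baxt_cong_lists)
  qed
  show "refl_on (lists {1..n}) (baxt_cong n)"
    using baxt_cong.refl by (rule refl_onI)
  show "sym (baxt_cong n)"
    using baxt_cong.sym by (rule symI)
  show "trans (baxt_cong n)"
    using baxt_cong.trans by (rule transI)
qed

lemma baxt_class_eqI:
  "(w, w') \<in> baxt_cong n \<Longrightarrow> baxt_cong n `` {w} = baxt_cong n `` {w'}"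
  using equiv_class_eq[OF equiv_baxt_cong] .

lemma baxt_mult_class:
  assumes "w \<in> lists {1..n}" "z \<in> lists {1..n}"
  shows "(baxt_cong n `` {w}) \<otimes>\<^bsub>baxt n\<^esub> (baxt_cong n `` {z}) = baxt_cong n `` {w @ z}"
proof -
  have eq: "baxt_cong n `` {w' @ z'} = baxt_cong n `` {w @ z}"
    if "w' \<in> baxt_cong n `` {w}" "z' \<in> baxt_cong n `` {z}" for w' z'
    using that unfolding Image_singleton_iff
    by (intro baxt_class_eqI[symmetric] baxt_cong.append)
  have "baxt_cong n `` {w} \<noteq> {}" "baxt_cong n `` {z} \<noteq> {}"
    using assms[THEN baxt_cong.refl] by auto
  then show ?thesis
    unfolding baxt_def monoid.simps by (intro SUP_eq_const eq)
qed

lemma monoid_baxt: "monoid (baxt n)"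
proof -
  have rep: "\<exists>w\<in>lists {1..n}. A = baxt_cong n `` {w}" if "A \<in> carrier (baxt n)" for A
    using that by (auto simp: baxt_def elim: quotientE)
  have closed: "baxt_cong n `` {w} \<in> carrier (baxt n)" if "w \<in> lists {1..n}" for w
    using that by (auto simp: baxt_def intro: quotientI)
  have one: "\<one>\<^bsub>baxt n\<^esub> = baxt_cong n `` {[]}"
    by (simp add: baxt_def)
  show ?thesis
  proof (rule monoidI)
    fix x y assume "x \<in> carrier (baxt n)" "y \<in> carrier (baxt n)"
    then obtain w z where "w \<in> lists {1..n}" "z \<in> lists {1..n}"
      "x = baxt_cong n `` {w}" "y = baxt_cong n `` {z}"
      using rep by meson
    then show "x \<otimes>\<^bsub>baxt n\<^esub> y \<in> carrier (baxt n)"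
      by (simp only: baxt_mult_class closed append_in_lists_conv)
  next
    show "\<one>\<^bsub>baxt n\<^esub> \<in> carrier (baxt n)"
      unfolding one by (rule closed) simp
  next
    fix x y z assume "x \<in> carrier (baxt n)" "y \<in> carrier (baxt n)" "z \<in> carrier (baxt n)"
    then obtain u v w where "u \<in> lists {1..n}" "v \<in> lists {1..n}" "w \<in> lists {1..n}"
      "x = baxt_cong n `` {u}" "y = baxt_cong n `` {v}" "z = baxt_cong n `` {w}"
      using rep by meson
    then show "x \<otimes>\<^bsub>baxt n\<^esub> y \<otimes>\<^bsub>baxt n\<^esub> z = x \<otimes>\<^bsub>baxt n\<^esub> (y \<otimes>\<^bsub>baxt n\<^esub> z)"
      by (simp only: baxt_mult_class append_in_lists_conv append_assoc)
  next
    fix x assume "x \<in> carrier (baxt n)"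
    then obtain w where "w \<in> lists {1..n}" "x = baxt_cong n `` {w}"
      using rep by meson
    then show "\<one>\<^bsub>baxt n\<^esub> \<otimes>\<^bsub>baxt n\<^esub> x = x" "x \<otimes>\<^bsub>baxt n\<^esub> \<one>\<^bsub>baxt n\<^esub> = x"
      unfolding one by (simp_all only: baxt_mult_class lists.Nil append_Nil append_Nil2)
  qed
qed

lemma sharp_word_lists: "w \<in> lists {1..n} \<Longrightarrow> sharp_word n w \<in> lists {1..n}"
  by (auto simp: sharp_word_def in_lists_conv_set)

lemma sharp_word_append: "sharp_word n (w @ z) = sharp_word n z @ sharp_word n w"
  by (simp add: sharp_word_def)

lemma sharp_word_rule:
  "baxt_rule n w w' \<Longrightarrow> baxt_rule n (sharp_word n w) (sharp_word n w')"
proof (induction rule: baxt_rule.induct)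
  case (1 a b c d u v)
  have "baxt_rule n
      ([n + 1 - b] @ sharp_word n v @ [n + 1 - d, n + 1 - a] @ sharp_word n u @ [n + 1 - c])
      ([n + 1 - b] @ sharp_word n v @ [n + 1 - a, n + 1 - d] @ sharp_word n u @ [n + 1 - c])"
    using 1 by (intro baxt_rule.intros(1) sharp_word_lists) auto
  then show ?case by (simp add: sharp_word_def)
next
  case (2 a b c d u v)
  have "baxt_rule n
      ([n + 1 - c] @ sharp_word n v @ [n + 1 - a, n + 1 - d] @ sharp_word n u @ [n + 1 - b])
      ([n + 1 - c] @ sharp_word n v @ [n + 1 - d, n + 1 - a] @ sharp_word n u @ [n + 1 - b])"
    using 2 by (intro baxt_rule.intros(2) sharp_word_lists) auto
  then show ?case by (simp add: sharp_word_def)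
qed

lemma sharp_word_cong:
  "(w, w') \<in> baxt_cong n \<Longrightarrow> (sharp_word n w, sharp_word n w') \<in> baxt_cong n"
proof (induction rule: baxt_cong.induct)
  case (rule w w')
  then show ?case by (intro baxt_cong.rule sharp_word_rule)
next
  case (refl w)
  then show ?case by (intro baxt_cong.refl sharp_word_lists)
next
  case (sym w w')
  then show ?case by (intro baxt_cong.sym[OF sym.IH])
next
  case (trans w w' w'')
  show ?case by (rule baxt_cong.trans[OF trans.IH])
next
  case (append w w' z z')
  show ?case unfolding sharp_word_append by (rule baxt_cong.append[OF append.IH(2) append.IH(1)])
qed

lemma sharp_class:
  assumes "w \<in> lists {1..n}"
  shows "sharp n (baxt_cong n `` {w}) = baxt_cong n `` {sharp_word n w}"
proof -
  have eq: "baxt_cong n `` {sharp_word n w'} = baxt_cong n `` {sharp_word n w}"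
    if "w' \<in> baxt_cong n `` {w}" for w'
    using that unfolding Image_singleton_iff
    by (intro baxt_class_eqI[symmetric] sharp_word_cong)
  have "baxt_cong n `` {w} \<noteq> {}"
    using assms[THEN baxt_cong.refl] by auto
  then show ?thesis
    unfolding sharp_def by (intro SUP_eq_const eq)
qed

section \<open>Word identities\<close>

text \<open>\<open>Plain x\<close> is the variable $x \in \mathcal{X}$ and \<open>Star x\<close> is its copy
  $x^* \in \mathcal{X}^*$, for \<open>'x\<close> the alphabet $\mathcal{X}$.\<close>

datatype 'x variable = Plain 'x | Star 'x

primrec eval_var :: "('m \<Rightarrow> 'm) \<Rightarrow> ('x \<Rightarrow> 'm) \<Rightarrow> 'x variable \<Rightarrow> 'm" where
  "eval_var star \<phi> (Plain x) = \<phi> x"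
| "eval_var star \<phi> (Star x) = star (\<phi> x)"

primrec eval_word ::
  "('m, 'b) monoid_scheme \<Rightarrow> ('m \<Rightarrow> 'm) \<Rightarrow> ('x \<Rightarrow> 'm) \<Rightarrow> 'x variable list \<Rightarrow> 'm" where
  "eval_word M star \<phi> [] = \<one>\<^bsub>M\<^esub>"
| "eval_word M star \<phi> (y # w) = eval_var star \<phi> y \<otimes>\<^bsub>M\<^esub> eval_word M star \<phi> w"

definition identity_holds ::
  "('m, 'b) monoid_scheme \<Rightarrow> ('m \<Rightarrow> 'm) \<Rightarrow> 'x variable list \<Rightarrow> 'x variable list \<Rightarrow> bool" where
  "identity_holds M star u v \<longleftrightarrow>
    (\<forall>\<phi> \<in> UNIV \<rightarrow> carrier M. eval_word M star \<phi> u = eval_word M star \<phi> v)"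

abbreviation con :: "'x variable list \<Rightarrow> 'x variable set" where
  "con u \<equiv> set u"

abbreviation occ :: "'x variable \<Rightarrow> 'x variable list \<Rightarrow> nat" where
  "occ x u \<equiv> count_list u x"

definition balanced :: "'x variable list \<Rightarrow> 'x variable list \<Rightarrow> bool" where
  "balanced u v \<longleftrightarrow> (\<forall>x \<in> con (u @ v). occ x u = occ x v)"

text \<open>\<open>occ_before y x u\<close> and \<open>occ_after y x u\<close> count the occurrences of \<open>x\<close> before the first
  and after the last occurrence of \<open>y\<close>. They are only meaningful for \<open>y \<in> con u\<close>.\<close>

definition occ_before :: "'x variable \<Rightarrow> 'x variable \<Rightarrow> 'x variable list \<Rightarrow> nat" where
  "occ_before y x u = occ x (takeWhile (\<lambda>z. z \<noteq> y) u)"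

definition occ_after :: "'x variable \<Rightarrow> 'x variable \<Rightarrow> 'x variable list \<Rightarrow> nat" where
  "occ_after y x u = occ x (takeWhile (\<lambda>z. z \<noteq> y) (rev u))"

end

theory Submission imports Defs begin

text \<open>For sufficiency, the counting conditions force two words to differ only by transpositions of
  adjacent variables each of which also occurs both to the left and to the right; after substitution
  every such transposition is a sequence of instances of the first defining relation (with \<open>a = b\<close>
  and \<open>c = d\<close>). For necessity, if no letter of a word lies strictly between \<open>a < d\<close>, then the number
  of \<open>a\<close> before the first \<open>d\<close> and the number of \<open>d\<close> after the last \<open>a\<close> are invariants of the
  congruence. Four letters suffice to send any two given variables to such a pair: \<open>1\<close> and \<open>2\<close>,
  or \<open>1\<close> and \<open>4\<close> if the variables are starred copies of each other.\<close>

section \<open>Commutation in the Baxter monoid\<close>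

lemma baxt_cong_context:
  assumes "(w, w') \<in> baxt_cong n" "p \<in> lists {1..n}" "q \<in> lists {1..n}"
  shows "(p @ w @ q, p @ w' @ q) \<in> baxt_cong n"
  using assms by (intro baxt_cong.append baxt_cong.refl)

text \<open>Any occurrence of \<open>d\<close> in \<open>p\<close> and any occurrence of
  \<open>a\<close> in \<open>q\<close> serve as the outer letters of the first relation, taken with
  \<open>c = d\<close> and \<open>b = a\<close>; what lies beyond them is context.\<close>

lemma baxt_cong_swap_less:
  assumes "p \<in> lists {1..n}" "q \<in> lists {1..n}" "a < d" "d \<in> set p" "a \<in> set q"
  shows "(p @ [a, d] @ q, p @ [d, a] @ q) \<in> baxt_cong n"
proof -
  obtain p1 p2 where p: "p = p1 @ [d] @ p2"
    using assms(4) by (auto simp: in_set_conv_decomp)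
  obtain q1 q2 where q: "q = q1 @ [a] @ q2"
    using assms(5) by (auto simp: in_set_conv_decomp)
  have "baxt_rule n ([d] @ p2 @ [a, d] @ q1 @ [a]) ([d] @ p2 @ [d, a] @ q1 @ [a])"
    using assms unfolding p q by (intro baxt_rule.intros) auto
  then have "(p1 @ ([d] @ p2 @ [a, d] @ q1 @ [a]) @ q2, p1 @ ([d] @ p2 @ [d, a] @ q1 @ [a]) @ q2)
      \<in> baxt_cong n"
    using assms unfolding p q by (intro baxt_cong_context baxt_cong.rule) auto
  then show ?thesis by (simp add: p q)
qed

lemma baxt_cong_swap:
  assumes "p \<in> lists {1..n}" "q \<in> lists {1..n}" "{x, y} \<subseteq> set p \<inter> set q"
  shows "(p @ [x, y] @ q, p @ [y, x] @ q) \<in> baxt_cong n"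
proof (cases x y rule: linorder_cases)
  case less
  then show ?thesis using assms by (intro baxt_cong_swap_less) auto
next
  case equal
  have "p @ [y, y] @ q \<in> lists {1..n}" using assms by auto
  then show ?thesis unfolding equal by (rule baxt_cong.refl)
next
  case greater
  then show ?thesis using assms by (intro baxt_cong.sym[OF baxt_cong_swap_less]) auto
qed

lemma baxt_cong_commute_letter:
  assumes "p \<in> lists {1..n}" "q \<in> lists {1..n}" "insert x (set t) \<subseteq> set p \<inter> set q"
  shows "(p @ [x] @ t @ q, p @ t @ [x] @ q) \<in> baxt_cong n"
  using assms
proof (induction t arbitrary: p)
  case Nil
  then have "p @ [x] @ q \<in> lists {1..n}" by auto
  then show ?case by (simp add: baxt_cong.refl)
next
  case (Cons y t)
  have "t \<in> lists {1..n}" using Cons.prems by auto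
  then have "(p @ [x, y] @ t @ q, p @ [y, x] @ t @ q) \<in> baxt_cong n"
    using Cons.prems by (intro baxt_cong_swap) auto
  \<comment> \<open>The letter just passed joins the left context, which only enlarges
    \<open>set p\<close>.\<close>
  moreover have "((p @ [y]) @ [x] @ t @ q, (p @ [y]) @ t @ [x] @ q) \<in> baxt_cong n"
    using Cons.prems by (intro Cons.IH) auto
  ultimately show ?case by (auto intro: baxt_cong.trans)
qed

lemma baxt_cong_commute:
  assumes "p \<in> lists {1..n}" "q \<in> lists {1..n}" "set s \<union> set t \<subseteq> set p \<inter> set q"
  shows "(p @ s @ t @ q, p @ t @ s @ q) \<in> baxt_cong n"
  using assms
proof (induction s arbitrary: p)
  case Nil
  then have "p @ t @ q \<in> lists {1..n}" by auto
  then show ?case by (simp add: baxt_cong.refl)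
next
  case (Cons x s)
  have "((p @ [x]) @ s @ t @ q, (p @ [x]) @ t @ s @ q) \<in> baxt_cong n"
    using Cons.prems by (intro Cons.IH) auto
  moreover have "s \<in> lists {1..n}" using Cons.prems by auto
  then have "(p @ [x] @ t @ s @ q, p @ t @ [x] @ s @ q) \<in> baxt_cong n"
    using Cons.prems by (intro baxt_cong_commute_letter) auto
  ultimately show ?case by (auto intro: baxt_cong.trans)
qed

section \<open>Words with the same occurrence counts\<close>

lemma occ_before_append:
  "occ_before y x (u @ v) =
    (if y \<in> set u then occ_before y x u else occ x u + occ_before y x v)"
  by (auto simp: occ_before_def takeWhile_append)

lemma occ_after_append:
  "occ_after y x (u @ v) =
    (if y \<in> set v then occ_after y x v else occ x v + occ_after y x u)"
  by (auto simp: occ_after_def takeWhile_append)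

lemma occ_before_Cons:
  "occ_before y x (z # u) = (if z = y then 0 else occ x [z] + occ_before y x u)"
  by (simp add: occ_before_def)

lemma occ_after_Cons:
  "occ_after y x (z # u) =
    (if y \<in> set u then occ_after y x u else occ x u + (if z = y then 0 else occ x [z]))"
  using occ_after_append[of y x "[z]" u] by (simp add: occ_after_def)

lemma occ_before_notin: "y \<notin> set u \<Longrightarrow> occ_before y x u = occ x u"
  using occ_before_append[of y x u "[]"] by (simp add: occ_before_def)

lemma occ_after_notin: "y \<notin> set u \<Longrightarrow> occ_after y x u = occ x u"
  using occ_after_append[of y x "[]" u] by (simp add: occ_after_def)

lemma occ_after_le: "occ_after y x u \<le> occ x u"
  by (induction u) (simp_all add: occ_after_Cons, simp add: occ_after_def)

lemma occ_pos_iff: "0 < occ x u \<longleftrightarrow> x \<in> set u"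
  using count_list_0_iff[of u x] by (simp add: neq0_conv[symmetric] del: neq0_conv)

text \<open>Quantifying over all variables, absent ones included, spares the inductions any
  membership conditions.\<close>

definition same_occs :: "'x variable list \<Rightarrow> 'x variable list \<Rightarrow> bool" where
  "same_occs u v \<longleftrightarrow> (\<forall>x. occ x u = occ x v) \<and>
    (\<forall>x y. occ_before y x u = occ_before y x v \<and> occ_after y x u = occ_after y x v)"

text \<open>Absent variables impose nothing new: if \<open>y\<close> is absent,
  \<open>takeWhile\<close> keeps the whole word and both counts are totals, fixed by balance; if
  \<open>x\<close> is absent, they are 0.\<close>

lemma same_occs_iff:
  "same_occs u v \<longleftrightarrow> balanced u v \<and>
    (\<forall>x \<in> con u. \<forall>y \<in> con u.
      occ_after x y u = occ_after x y v \<and> occ_before x y u = occ_before x y v)"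
  (is "_ \<longleftrightarrow> ?R")
proof
  show "same_occs u v \<Longrightarrow> ?R" by (simp add: same_occs_def balanced_def)
next
  assume R: ?R
  have occ: "occ x u = occ x v" for x
    using R by (cases "x \<in> con (u @ v)") (auto simp: balanced_def)
  then have con: "x \<in> con u \<longleftrightarrow> x \<in> con v" for x by (simp flip: occ_pos_iff)
  have "occ_before y x u = occ_before y x v \<and> occ_after y x u = occ_after y x v" for x y
  proof (cases "y \<in> con u")
    case False
    then show ?thesis using con occ by (simp add: occ_before_notin occ_after_notin)
  next
    case y: True
    show ?thesis
    proof (cases "x \<in> con u")
      case True
      with y R show ?thesis by blast
    next
      case False
      then have "occ_before y x w = 0 \<and> occ_after y x w = 0" if "w = u \<or> w = v" for w
        using that con unfolding occ_before_def occ_after_def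
        by (auto simp: count_list_0_iff dest: set_takeWhileD)
      then show ?thesis by simp
    qed
  qed
  then show "same_occs u v" using occ by (simp add: same_occs_def)
qed

text \<open>Variables of \<open>s\<close> and \<open>t\<close> have their first occurrence in
  \<open>p\<close> and their last in \<open>q\<close>. For any other \<open>y\<close>, the two
  blocks lie on the same side of the relevant \<open>y\<close>, so only their total content
  matters.\<close>

lemma same_occs_commute:
  assumes "set s \<union> set t \<subseteq> set p \<inter> set q"
  shows "same_occs (p @ s @ t @ q) (p @ t @ s @ q)"
  using assms by (auto simp: same_occs_def occ_before_append occ_after_append)

lemma same_occs_trans: "same_occs u v \<Longrightarrow> same_occs v w \<Longrightarrow> same_occs u w"
  by (simp add: same_occs_def)

text \<open>The combinatorial core of sufficiency: moving \<open>x\<close> to the front of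
  \<open>s\<close> is forced to be a legal commutation. A variable missing from \<open>p\<close>
  would change a count before its first occurrence, one missing from \<open>v\<close> a count after
  its last.\<close>

lemma same_occs_shift:
  assumes "same_occs (p @ x # u) (p @ s @ x # v)" "x \<notin> set s" "s \<noteq> []"
  shows "insert x (set s) \<subseteq> set p \<inter> set v"
proof -
  have occ: "occ z (p @ x # u) = occ z (p @ s @ x # v)"
    and before: "occ_before z z' (p @ x # u) = occ_before z z' (p @ s @ x # v)"
    and after: "occ_after z z' (p @ x # u) = occ_after z z' (p @ s @ x # v)" for z z'
    using assms(1) by (simp_all add: same_occs_def)
  have occ': "occ z u = occ z s + occ z v" for z
    using occ[of z] by (simp split: if_splits)
  obtain y where y: "y \<in> set s" using \<open>s \<noteq> []\<close> by (cases s) auto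
  then have ypos: "0 < occ y s" and "y \<noteq> x" using assms(2) by (auto simp: occ_pos_iff)
  have "x \<in> set p"
    using before[of x y] ypos assms(2) \<open>y \<noteq> x\<close>
    by (auto simp: occ_before_append occ_before_Cons split: if_splits)
  moreover have "x \<in> set v"
  proof (rule ccontr)
    assume "x \<notin> set v"
    then have "x \<notin> set u" using occ'[of x] assms(2) by (simp flip: occ_pos_iff)
    then show False
      using after[of x y] \<open>x \<notin> set v\<close> ypos \<open>y \<noteq> x\<close> occ'[of y]
      by (simp add: occ_after_append occ_after_Cons)
  qed
  moreover have "z \<in> set p \<and> z \<in> set v" if z: "z \<in> set s" for z
  proof
    have "z \<noteq> x" using z assms(2) by auto
    have "0 < occ z u" using z occ'[of z] by (simp flip: occ_pos_iff)
    then have zu: "z \<in> set u" by (simp add: occ_pos_iff)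
    \<comment> \<open>If \<open>z\<close> were not in \<open>p\<close>, the \<open>x\<close>
      following \<open>p\<close> on the left would precede the first \<open>z\<close>, while on the
      right no \<open>x\<close> lies between \<open>p\<close> and the first
      \<open>z\<close>.\<close>
    have "occ_before z x s = 0"
      using assms(2) by (auto simp: occ_before_def count_list_0_iff dest: set_takeWhileD)
    then show "z \<in> set p"
      using before[of z x] z \<open>z \<noteq> x\<close>
      by (auto simp: occ_before_append occ_before_Cons split: if_splits)
    show "z \<in> set v"
    proof (rule ccontr)
      assume "z \<notin> set v"
      have "occ x s = 0" using assms(2) by (simp add: count_list_0_iff)
      \<comment> \<open>On the left the last \<open>z\<close> lies in \<open>u\<close>, so at most
        \<open>occ x u = occ x v\<close> copies of \<open>x\<close> follow it; on the right it lies
        in \<open>s\<close>, so the displayed \<open>x\<close> and all those of \<open>v\<close>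
        follow.\<close>
      have "occ_after z x (p @ x # u) = occ_after z x u"
        using zu by (simp add: occ_after_append occ_after_Cons)
      moreover have "occ_after z x (p @ s @ x # v) = occ x v + 1 + occ_after z x s"
        using z \<open>z \<notin> set v\<close> \<open>z \<noteq> x\<close> by (simp add: occ_after_append occ_after_Cons)
      ultimately show False
        using after[of z x] occ_after_le[of z x u] occ'[of x] \<open>occ x s = 0\<close> by simp
    qed
  qed
  ultimately show ?thesis by auto
qed

lemma concat_map_lists: "(\<And>z. f z \<in> lists A) \<Longrightarrow> concat (map f w) \<in> lists A"
  by (induction w) auto

text \<open>Induction on \<open>u\<close> with a growing common prefix \<open>p\<close>: the first
  \<open>x\<close> in \<open>v\<close> is moved to the front past \<open>s\<close>. The variables
  moved occur in both \<open>p\<close> and \<open>t\<close>, so the letters of their images occur on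
  both sides as well.\<close>

lemma baxt_cong_if_same_occs:
  assumes "\<And>z. f z \<in> lists {1..n}" "same_occs (p @ u) (p @ v)"
  shows "(concat (map f (p @ u)), concat (map f (p @ v))) \<in> baxt_cong n"
  using assms(2)
proof (induction u arbitrary: p v)
  case Nil
  then have "occ z v = 0" for z by (simp add: same_occs_def)
  then have "z \<notin> set v" for z by (metis count_list_0_iff)
  then have "v = []" by (cases v) auto
  moreover have "concat (map f p) \<in> lists {1..n}" using assms(1) by (rule concat_map_lists)
  ultimately show ?case by (simp add: baxt_cong.refl)
next
  case (Cons x u)
  have "occ x (p @ x # u) = occ x (p @ v)" using Cons.prems unfolding same_occs_def by blast
  then have "0 < occ x v" by simp
  then have "x \<in> set v" by (simp only: occ_pos_iff)
  then obtain s t where v: "v = s @ x # t" and "x \<notin> set s"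
    by (metis split_list_first)
  have sub: "set s \<union> set [x] \<subseteq> set p \<inter> set t" if "s \<noteq> []"
    using same_occs_shift[of p x u s t] Cons.prems \<open>x \<notin> set s\<close> that by (auto simp: v)
  have in_lists: "concat (map f w) \<in> lists {1..n}" for w
    using assms(1) by (rule concat_map_lists)
  have "same_occs (p @ s @ [x] @ t) (p @ [x] @ s @ t)"
    using same_occs_commute[OF sub] by (cases "s = []") (auto simp: same_occs_def)
  with Cons.prems have "same_occs ((p @ [x]) @ u) ((p @ [x]) @ s @ t)"
    unfolding v by (auto intro: same_occs_trans)
  then have "(concat (map f ((p @ [x]) @ u)), concat (map f ((p @ [x]) @ s @ t))) \<in> baxt_cong n"
    by (rule Cons.IH)
  moreover have "(concat (map f p) @ f x @ concat (map f s) @ concat (map f t),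
      concat (map f p) @ concat (map f s) @ f x @ concat (map f t)) \<in> baxt_cong n"
  proof (cases "s = []")
    case True
    have "concat (map f p) @ f x @ concat (map f t) \<in> lists {1..n}"
      using in_lists[of "p @ [x] @ t"] by simp
    with True show ?thesis by (simp add: baxt_cong.refl)
  next
    case False
    then show ?thesis using sub in_lists by (intro baxt_cong_commute) auto
  qed
  ultimately show ?case unfolding v by (auto intro: baxt_cong.trans)
qed

section \<open>Invariants of the Baxter congruence\<close>

lemma baxt_cong_count: "(w, w') \<in> baxt_cong n \<Longrightarrow> count_list w a = count_list w' a"
proof (induction rule: baxt_cong.induct)
  case (rule w w')
  then show ?case by (cases rule: baxt_rule.cases) auto
qed auto

lemma baxt_cong_set:
  assumes "(w, w') \<in> baxt_cong n"
  shows "set w = set w'"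
proof (rule Set.set_eqI)
  fix a
  show "a \<in> set w \<longleftrightarrow> a \<in> set w'"
    using baxt_cong_count[OF assms, of a] count_list_0_iff[of w a] count_list_0_iff[of w' a] by simp
qed

text \<open>One shape for both relations, so that each invariant is checked once. In the first, the
  outer letters satisfy only \<open>c \<le> d\<close> and \<open>a \<le> b\<close> at the ends; in
  the second, both lie strictly between \<open>a\<close> and \<open>d\<close>.\<close>

lemma baxt_rule_swap:
  assumes "baxt_rule n w w'"
  obtains p x y q where "w = p @ [x, y] @ q" "w' = p @ [y, x] @ q" "x \<noteq> y"
    "\<exists>z \<in> set p. min x y < z \<and> z \<le> max x y" "\<exists>z \<in> set q. min x y \<le> z \<and> z < max x y"
  using assms
proof (cases rule: baxt_rule.cases)
  case (1 a b c d u v)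
  show thesis by (rule that[of "c # u" a d "v @ [b]"]) (use 1 in auto)
next
  case (2 a b c d u v)
  show thesis by (rule that[of "b # u" d a "v @ [c]"]) (use 2 in auto)
qed

text \<open>Only exchanging \<open>a\<close> with \<open>d\<close> could alter the count. The left
  witness then lies in \<open>{a<..d}\<close>, hence equals \<open>d\<close> as the gap is empty, so
  the first \<open>d\<close> precedes the exchange.\<close>

lemma baxt_rule_count_before:
  assumes "baxt_rule n w w'" "a < d" "set w \<inter> {a<..<d} = {}"
  shows "count_list (takeWhile (\<lambda>i. i \<noteq> d) w) a = count_list (takeWhile (\<lambda>i. i \<noteq> d) w') a"
  using assms(1)
proof (cases rule: baxt_rule_swap)
  case (1 p x y q)
  obtain z where z: "z \<in> set p" "min x y < z" "z \<le> max x y" using 1(4) by blast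
  have "d \<in> set p \<or> {x, y} \<noteq> {a, d}"
  proof (rule ccontr)
    assume "\<not> ?thesis"
    then have "d \<notin> set p" "min x y = a" "max x y = d" using assms(2) by (auto simp: doubleton_eq_iff)
    then have "z \<in> set w \<inter> {a<..<d}" using z 1(1) by (cases "z = d") auto
    then show False using assms(3) by blast
  qed
  then show ?thesis
    unfolding 1(1,2) by (cases "d \<in> set p") (auto simp: takeWhile_append)
qed

text \<open>Mirror image: the right witness must be \<open>a\<close>, so the last \<open>a\<close>
  comes after the exchange.\<close>

lemma baxt_rule_count_after:
  assumes "baxt_rule n w w'" "a < d" "set w \<inter> {a<..<d} = {}"
  shows "count_list (takeWhile (\<lambda>i. i \<noteq> a) (rev w)) d =
    count_list (takeWhile (\<lambda>i. i \<noteq> a) (rev w')) d"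
  using assms(1)
proof (cases rule: baxt_rule_swap)
  case (1 p x y q)
  obtain z where z: "z \<in> set q" "min x y \<le> z" "z < max x y" using 1(5) by blast
  have "a \<in> set q \<or> {x, y} \<noteq> {a, d}"
  proof (rule ccontr)
    assume "\<not> ?thesis"
    then have "a \<notin> set q" "min x y = a" "max x y = d" using assms(2) by (auto simp: doubleton_eq_iff)
    then have "z \<in> set w \<inter> {a<..<d}" using z 1(1) by (cases "z = a") auto
    then show False using assms(3) by blast
  qed
  then show ?thesis
    unfolding 1(1,2) by (cases "a \<in> set q") (auto simp: takeWhile_append)
qed

text \<open>The gap condition passes along the congruence because content is invariant. For
  products, if \<open>d\<close> is missing from the left factor, its total count of \<open>a\<close>
  is added, which is also invariant.\<close>

lemma baxt_cong_count_before:
  assumes "(w, w') \<in> baxt_cong n" "a < d" "set w \<inter> {a<..<d} = {}"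
  shows "count_list (takeWhile (\<lambda>i. i \<noteq> d) w) a = count_list (takeWhile (\<lambda>i. i \<noteq> d) w') a"
  using assms
proof (induction rule: baxt_cong.induct)
  case (rule w w')
  then show ?case by (rule baxt_rule_count_before)
next
  case (append w w' z z')
  have "count_list (takeWhile (\<lambda>i. i \<noteq> d) w) a = count_list (takeWhile (\<lambda>i. i \<noteq> d) w') a"
    "count_list (takeWhile (\<lambda>i. i \<noteq> d) z) a = count_list (takeWhile (\<lambda>i. i \<noteq> d) z') a"
    using append.prems by (auto intro!: append.IH)
  then show ?case
    using append.hyps[THEN baxt_cong_set] append.hyps[THEN baxt_cong_count]
    by (auto simp: takeWhile_append)
qed (auto simp: baxt_cong_set)

lemma baxt_cong_count_after:
  assumes "(w, w') \<in> baxt_cong n" "a < d" "set w \<inter> {a<..<d} = {}"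
  shows "count_list (takeWhile (\<lambda>i. i \<noteq> a) (rev w)) d =
    count_list (takeWhile (\<lambda>i. i \<noteq> a) (rev w')) d"
  using assms
proof (induction rule: baxt_cong.induct)
  case (rule w w')
  then show ?case by (rule baxt_rule_count_after)
next
  case (append w w' z z')
  have "count_list (takeWhile (\<lambda>i. i \<noteq> a) (rev w)) d = count_list (takeWhile (\<lambda>i. i \<noteq> a) (rev w')) d"
    "count_list (takeWhile (\<lambda>i. i \<noteq> a) (rev z)) d = count_list (takeWhile (\<lambda>i. i \<noteq> a) (rev z')) d"
    using append.prems by (auto intro!: append.IH)
  then show ?case
    using append.hyps[THEN baxt_cong_set] append.hyps[THEN baxt_cong_count]
    by (auto simp: takeWhile_append)
qed (auto simp: baxt_cong_set)

section \<open>Evaluation of identities on words\<close>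

abbreviation sharp_subst :: "nat \<Rightarrow> ('x \<Rightarrow> nat list) \<Rightarrow> 'x variable \<Rightarrow> nat list" where
  "sharp_subst n g \<equiv> eval_var (sharp_word n) g"

lemma sharp_subst_lists:
  assumes "\<And>x. g x \<in> lists {1..n}"
  shows "sharp_subst n g z \<in> lists {1..n}"
  using assms sharp_word_lists by (cases z) auto

lemma eval_word_baxt:
  assumes "\<And>x. g x \<in> lists {1..n}"
  shows "eval_word (baxt n) (sharp n) (\<lambda>x. baxt_cong n `` {g x}) w =
    baxt_cong n `` {concat (map (sharp_subst n g) w)}"
proof (induction w)
  case Nil
  show ?case by (simp add: baxt_def)
next
  case (Cons z w)
  have "eval_var (sharp n) (\<lambda>x. baxt_cong n `` {g x}) z = baxt_cong n `` {sharp_subst n g z}"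
    using assms by (cases z) (simp_all add: sharp_class)
  moreover have "concat (map (sharp_subst n g) w) \<in> lists {1..n}"
    using sharp_subst_lists[OF assms] by (rule concat_map_lists)
  ultimately show ?case
    using Cons.IH baxt_mult_class[OF sharp_subst_lists[of g, OF assms]] by simp
qed

text \<open>Choosing representatives lets both directions work with substitutions of words instead
  of classes.\<close>

lemma identity_holds_baxt_iff:
  "identity_holds (baxt n) (sharp n) u v \<longleftrightarrow>
    (\<forall>g. (\<forall>x. g x \<in> lists {1..n}) \<longrightarrow>
      (concat (map (sharp_subst n g) u), concat (map (sharp_subst n g) v)) \<in> baxt_cong n)"
  (is "?L \<longleftrightarrow> ?R")
proof
  assume L: ?L
  show ?R
  proof (intro allI impI)
    fix g :: "'a \<Rightarrow> nat list" assume g: "\<forall>x. g x \<in> lists {1..n}"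
    then have "(\<lambda>x. baxt_cong n `` {g x}) \<in> UNIV \<rightarrow> carrier (baxt n)"
      by (auto simp: baxt_def intro: quotientI)
    with L have "baxt_cong n `` {concat (map (sharp_subst n g) u)} =
        baxt_cong n `` {concat (map (sharp_subst n g) v)}"
      using g by (auto simp: identity_holds_def simp flip: eval_word_baxt)
    moreover have "concat (map (sharp_subst n g) v) \<in> lists {1..n}"
      using g by (intro concat_map_lists sharp_subst_lists) blast
    ultimately show "(concat (map (sharp_subst n g) u), concat (map (sharp_subst n g) v)) \<in> baxt_cong n"
      by (metis eq_equiv_class equiv_baxt_cong)
  qed
next
  assume R: ?R
  show ?L
    unfolding identity_holds_def
  proof
    fix \<phi> :: "'a \<Rightarrow> nat list set" assume "\<phi> \<in> UNIV \<rightarrow> carrier (baxt n)"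
    then have "\<forall>x. \<exists>w. w \<in> lists {1..n} \<and> \<phi> x = baxt_cong n `` {w}"
      by (auto simp: baxt_def Pi_iff elim!: quotientE) (metis quotientE)
    then obtain g where g: "\<And>x. g x \<in> lists {1..n}" and "\<And>x. \<phi> x = baxt_cong n `` {g x}"
      by metis
    then have \<phi>: "\<phi> = (\<lambda>x. baxt_cong n `` {g x})" by auto
    show "eval_word (baxt n) (sharp n) \<phi> u = eval_word (baxt n) (sharp n) \<phi> v"
      unfolding \<phi> eval_word_baxt[OF g] using R g by (intro baxt_class_eqI) blast
  qed
qed

section \<open>Substitutions separating two variables, and necessity\<close>

lemma count_concat_map:
  assumes "f x = [a]" "\<And>z. z \<noteq> x \<Longrightarrow> a \<notin> set (f z)"
  shows "count_list (concat (map f w)) a = occ x w"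
  using assms by (induction w) (auto simp: count_list_0_iff)

lemma count_before_concat_map:
  assumes "f x = [a]" "f y = [d]" "x \<noteq> y" "a \<noteq> d"
    and "\<And>z. z \<noteq> x \<Longrightarrow> z \<noteq> y \<Longrightarrow> a \<notin> set (f z) \<and> d \<notin> set (f z)"
  shows "count_list (takeWhile (\<lambda>i. i \<noteq> d) (concat (map f w))) a = occ_before y x w"
proof (induction w)
  case Nil
  show ?case by (simp add: occ_before_def)
next
  case (Cons z w)
  consider "z = x" | "z = y" | "z \<noteq> x" "z \<noteq> y" by blast
  then show ?case
  proof cases
    case 3
    then have "a \<notin> set (f z)" "\<forall>i \<in> set (f z). i \<noteq> d" using assms(5) by auto
    with 3 Cons.IH show ?thesis
      by (simp add: takeWhile_append occ_before_Cons count_list_0_iff)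
  qed (use Cons.IH assms(1-4) in \<open>auto simp: occ_before_Cons\<close>)
qed

lemma count_after_concat_map:
  assumes "f x = [a]" "f y = [d]" "x \<noteq> y" "a \<noteq> d"
    and "\<And>z. z \<noteq> x \<Longrightarrow> z \<noteq> y \<Longrightarrow> a \<notin> set (f z) \<and> d \<notin> set (f z)"
  shows "count_list (takeWhile (\<lambda>i. i \<noteq> d) (rev (concat (map f w)))) a = occ_after y x w"
proof -
  \<comment> \<open>Reversed images still satisfy the hypotheses, since singletons are their own
    reversals.\<close>
  have "rev (concat (map f w)) = concat (map (\<lambda>z. rev (f z)) (rev w))"
    by (simp add: rev_concat rev_map comp_def)
  then show ?thesis
    using count_before_concat_map[of "\<lambda>z. rev (f z)" x a y d "rev w"] assms
    by (simp add: occ_before_def occ_after_def)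
qed

text \<open>If \<open>x\<close> and \<open>y\<close> are starred copies of each other, sending
  \<open>x\<close> to 1 forces \<open>y\<close> to 4 and all else can be empty. Otherwise they go to
  1 and 2, their copies to 4 and 3, and the rest to the empty word.\<close>

lemma exists_separating_subst:
  fixes x y :: "'x variable"
  assumes "x \<noteq> y"
  obtains g d where "\<And>i. g i \<in> lists {1..4}" "1 < d"
    "sharp_subst 4 g x = [1]" "sharp_subst 4 g y = [d]"
    "\<And>z. z \<noteq> x \<Longrightarrow> z \<noteq> y \<Longrightarrow> set (sharp_subst 4 g z) \<inter> {1..d} = {}"
proof -
  define name :: "'x variable \<Rightarrow> 'x" where "name z = (case z of Plain i \<Rightarrow> i | Star i \<Rightarrow> i)" for z
  \<comment> \<open>The letter to assign to the underlying name so that \<open>z\<close> itself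
    evaluates to \<open>a\<close>; \<open>5 - a\<close> is the image of \<open>a\<close> under the
    involution.\<close>
  define val :: "'x variable \<Rightarrow> nat \<Rightarrow> nat" where
    "val z a = (case z of Plain i \<Rightarrow> a | Star i \<Rightarrow> 5 - a)" for z a
  show thesis
  proof (cases "name x = name y")
    case True
    define g where "g i = (if i = name x then [val x 1] else [])" for i
    show thesis
    proof (rule that[of g 4])
      fix z assume "z \<noteq> x" "z \<noteq> y"
      then show "set (sharp_subst 4 g z) \<inter> {1..4} = {}"
        using True assms
        by (cases x; cases y; cases z) (auto simp: g_def name_def sharp_word_def)
    qed (use True assms in \<open>cases x; cases y;
        auto simp: g_def name_def val_def sharp_word_def\<close>)+
  next
    case False
    define g where
      "g i = (if i = name x then [val x 1] else if i = name y then [val y 2] else [])" for i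
    show thesis
    proof (rule that[of g 2])
      fix z assume "z \<noteq> x" "z \<noteq> y"
      then show "set (sharp_subst 4 g z) \<inter> {1..2} = {}"
        using False assms
        by (cases x; cases y; cases z) (auto simp: g_def name_def val_def sharp_word_def)
    qed (use False assms in \<open>cases x; cases y;
        auto simp: g_def name_def val_def sharp_word_def\<close>)+
  qed
qed

lemma same_occs_if_identity_holds:
  assumes "identity_holds (baxt 4) (sharp 4) u v"
  shows "same_occs u v"
proof -
  \<comment> \<open>With \<open>x\<close> sent to the smaller letter, the invariants see only
    \<open>x\<close> before the first \<open>y\<close> and \<open>y\<close> after the last
    \<open>x\<close>; the other two counts come from exchanging the roles.\<close>
  have main: "occ x u = occ x v \<and> occ_before y x u = occ_before y x v \<and>
      occ_after x y u = occ_after x y v" if neq: "x \<noteq> y" for x y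
  proof -
    obtain g d where g: "\<And>i. g i \<in> lists {1..4}" and d: "1 < d"
      and x: "sharp_subst 4 g x = [1]" and y: "sharp_subst 4 g y = [d]"
      and z: "\<And>z. z \<noteq> x \<Longrightarrow> z \<noteq> y \<Longrightarrow> set (sharp_subst 4 g z) \<inter> {1..d} = {}"
      using exists_separating_subst[OF neq] by metis
    let ?f = "sharp_subst 4 g"
    have z': "1 \<notin> set (?f z) \<and> d \<notin> set (?f z)" if "z \<noteq> x" "z \<noteq> y" for z
      using z[OF that] d by auto
    then have x': "1 \<notin> set (?f z)" if "z \<noteq> x" for z
      using that y d by (cases "z = y") auto
    have cong: "(concat (map ?f u), concat (map ?f v)) \<in> baxt_cong 4"
      using assms g by (simp add: identity_holds_baxt_iff)
    have "set (?f z) \<inter> {1<..<d} = {}" for z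
      using z[of z] x y by (cases "z = x"; cases "z = y") auto
    then have gap: "set (concat (map ?f u)) \<inter> {1<..<d} = {}" by auto
    have "occ x u = occ x v"
      using baxt_cong_count[OF cong, of 1] count_concat_map[of ?f x 1] x x' by simp
    moreover have "occ_before y x u = occ_before y x v"
      using baxt_cong_count_before[OF cong d gap]
        count_before_concat_map[of ?f x 1 y d] x y z' neq d by simp
    moreover have "occ_after x y u = occ_after x y v"
      using baxt_cong_count_after[OF cong d gap]
        count_after_concat_map[of ?f y d x 1] x y z' neq d by simp
    ultimately show ?thesis by blast
  qed
  have "occ x u = occ x v" for x
  proof -
    \<comment> \<open>An auxiliary second variable, since \<open>main\<close> speaks of distinct
      pairs.\<close>
    obtain y where "x \<noteq> y" using variable.distinct(1) by metis
    then show ?thesis using main by blast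
  qed
  moreover have "occ_before y x u = occ_before y x v \<and> occ_after y x u = occ_after y x v" for x y
  proof (cases "x = y")
    case True
    have "occ_before y y w = 0 \<and> occ_after y y w = 0" for w
      by (auto simp: occ_before_def occ_after_def count_list_0_iff dest: set_takeWhileD)
    with True show ?thesis by simp
  next
    case False
    then show ?thesis using main[of x y] main[of y x] by simp
  qed
  ultimately show ?thesis by (simp add: same_occs_def)
qed

theorem theorem4p4:
  fixes u v :: "nat variable list"
  assumes "u \<noteq> []" and "v \<noteq> []"
  shows "identity_holds (baxt 4) (sharp 4) u v \<longleftrightarrow>
    balanced u v \<and>
    (\<forall>x \<in> con u. \<forall>y \<in> con u.
      occ_after x y u = occ_after x y v \<and> occ_before x y u = occ_before x y v)"
  unfolding same_occs_iff[symmetric]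
proof
  assume "identity_holds (baxt 4) (sharp 4) u v"
  then show "same_occs u v" by (rule same_occs_if_identity_holds)
next
  assume "same_occs u v"
  then show "identity_holds (baxt 4) (sharp 4) u v"
    unfolding identity_holds_baxt_iff
    using baxt_cong_if_same_occs[of _ 4 "[]" u v] sharp_subst_lists[of _ 4]
    unfolding append_Nil by blast
qed

end
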